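(* Let $B$ be a bicyclic graph. Then $\det A(B)\in\{0,\pm1,\pm2,\pm3,\pm4,\pm5,\pm8,\pm9,\pm16\}$.
   Context: All graphs are finite, undirected and simple. A connected graph $B$ is bicyclic if $|E(B)|=|V(B)|+1$. $A(B)$ denotes the $0$-$1$ adjacency matrix of $B$. *)

theory Defs
  imports "Graph_Theory.Pair_Digraph" "Graph_Theory.Digraph_Component" "Jordan_Normal_Form.Determinant"
begin

text \<open>
  A finite undirected simple graph is a \<^locale>\<open>pair_graph\<close>: a finite digraph without loops whose
  arc set, a set of ordered pairs of vertices, is symmetric. Every undirected edge is thus stored
  as two opposite arcs; the edge set proper consists of unordered pairs.
\<close>

definition edge_set :: "'a pair_pre_digraph \<Rightarrow> 'a set set" where
  "edge_set G = (\<lambda>(u, v). {u, v}) ` parcs G"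

text \<open>
  \<^const>\<open>Digraph_Component.connected\<close> also demands that there is at least one vertex.
\<close>

definition bicyclic :: "'a pair_pre_digraph \<Rightarrow> bool" where
  "bicyclic G \<longleftrightarrow> pair_graph G \<and> Digraph_Component.connected (with_proj G)
     \<and> card (edge_set G) = card (pverts G) + 1"

text \<open>
  The rows and columns are indexed in the order of \<open>vs\<close>, which is meant to list every vertex of
  \<open>G\<close> exactly once.
\<close>

definition adjacency_matrix :: "'a pair_pre_digraph \<Rightarrow> 'a list \<Rightarrow> int mat" where
  "adjacency_matrix G vs =
     mat (length vs) (length vs) (\<lambda>(i, j). if (vs ! i, vs ! j) \<in> parcs G then 1 else 0)"

end

theory Submission
  imports Defs "HOL-Library.Z2"
begin

text \<open>
  A connected graph with one more edge than vertices is a spanning tree together with two further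
  edges \<open>ab\<close> and \<open>cd\<close>. Its adjacency matrix is therefore the matrix \<open>F\<close> of the tree with four entries
  added. Expanding the determinant along the rows of these entries writes it as a sum of at most 16
  determinants of copies of \<open>F\<close> in which some rows are replaced by unit vectors. Two facts about trees
  control these summands.

  \<^item> Each summand is \<open>-1\<close>, \<open>0\<close> or \<open>1\<close>: the nonzero entries, seen as edges between rows and columns,
    form a forest, so some row or column has a single nonzero entry, and deleting the row and the
    column of that entry leaves a smaller matrix of the same kind (\<open>unit_rows_det_forest\<close>).

  \<^item> Colour the tree properly with the colours \<open>1\<close> and \<open>-1\<close>. A summand vanishes unless the colours at
    the replaced entries add up to twice the difference of the sizes of the two colour classes
    (\<open>unit_rows_det_nonzero_imp_colour_sum\<close>).

  It remains to see which of the two extra edges join vertices of different colours.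

  \<^item> If both do, the graph is bipartite, so its determinant is plus or minus a square
    (\<open>det_bipartite_symmetric\<close>), and it is at most 16 in absolute value.

  \<^item> If only \<open>cd\<close> does, either at most four summands survive, or the determinant is \<open>2 * N\<close>, where
    \<open>N\<close> is the cofactor at \<open>(a, b)\<close> of the singular symmetric matrix \<open>M\<close> of the tree with \<open>cd\<close>. The
    cofactor matrix of a singular matrix has rank at most one, so \<open>N\<^sup>2\<close> is the product of the principal cofactors at
    \<open>a\<close> and \<open>b\<close>. These belong to bipartite graphs and are at most 4 in absolute value, hence they are
    \<open>0\<close> or \<open>1\<close> or \<open>4\<close> up to sign. As \<open>N\<close> is at most 4 in absolute value as well, and \<open>9\<close> is not a
    product of two numbers among these, \<open>N\<close> is \<open>0\<close>, \<open>1\<close>, \<open>2\<close> or \<open>4\<close> up to sign.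

  \<^item> If neither does, at most six summands survive, and at most four if the number of vertices is
    odd. The value 6 is impossible for an even number of vertices, because an even determinant of a
    symmetric integer matrix of even order with even diagonal is divisible by 4
    (\<open>det_symmetric_even_diag_mod_4\<close>).
\<close>

section \<open>Cofactors and single rows\<close>

lemma cofactor_cong_row:
  assumes "dim_row A = dim_row B" "dim_col A = dim_col B"
    and "\<And>k l. k < dim_row A \<Longrightarrow> l < dim_col A \<Longrightarrow> k \<noteq> i \<Longrightarrow> A $$ (k, l) = B $$ (k, l)"
  shows "cofactor A i j = cofactor B i j"
proof -
  have "mat_delete A i j = mat_delete B i j"
    unfolding mat_delete_def using assms by (intro eq_matI) auto
  then show ?thesis
    by (simp add: cofactor_def)
qed

lemma cofactor_transpose:
  assumes A: "A \<in> carrier_mat n n"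
  shows "cofactor A\<^sup>T i j = cofactor A j i"
proof -
  have "mat_delete A\<^sup>T i j = (mat_delete A j i)\<^sup>T"
    using A by (intro eq_matI) (auto simp: mat_delete_def)
  then show ?thesis
    using det_transpose[OF mat_delete_carrier[OF A]] by (simp add: cofactor_def add.commute)
qed

lemma det_unit_row:
  assumes A: "A \<in> carrier_mat n n" and "i < n" "j < n"
  shows "det (mat n n (\<lambda>(k, l). if k = i then of_bool (l = j) else A $$ (k, l))) = cofactor A i j"
proof -
  let ?M = "mat n n (\<lambda>(k, l). if k = i then of_bool (l = j) else A $$ (k, l))"
  have "cofactor ?M i l = cofactor A i l" for l
    by (rule cofactor_cong_row) (use A in auto)
  then have "det ?M = (\<Sum>l<n. of_bool (l = j) * cofactor A i l)"
    using laplace_expansion_row[of ?M n i] assms by simp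
  also have "\<dots> = cofactor A i j"
    using \<open>j < n\<close> by (simp add: of_bool_def if_distrib[of "\<lambda>x. x * _"] cong: if_cong)
  finally show ?thesis .
qed

section \<open>Determinants whose support is a forest\<close>

text \<open>
  A relation is read as a bipartite graph between rows and columns. Instead of speaking about cycles,
  acyclicity is expressed by its hereditary consequence for finite graphs: every nonempty set of edges
  has a leaf, which may be a row or a column. This passes to subsets at once, and a leaf is exactly
  what Laplace expansion needs.
\<close>

definition forest_relation :: "('r \<times> 'c) set \<Rightarrow> bool" where
  "forest_relation E \<longleftrightarrow> (\<forall>E'\<subseteq>E. E' \<noteq> {} \<longrightarrow>
     (\<exists>i j. (i, j) \<in> E' \<and> ((\<forall>l. (i, l) \<in> E' \<longrightarrow> l = j) \<or> (\<forall>k. (k, j) \<in> E' \<longrightarrow> k = i))))"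

text \<open>
  Deleting a row and a column of a matrix renumbers the remaining ones by injective maps, so this
  carries the forest property over to minors.
\<close>

lemma forest_relation_inv_image:
  assumes E: "forest_relation E" and f: "inj f" and g: "inj g"
    and D: "\<And>i j. (i, j) \<in> D \<Longrightarrow> (f i, g j) \<in> E"
  shows "forest_relation D"
  unfolding forest_relation_def
proof (intro allI impI)
  fix D' assume D': "D' \<subseteq> D" "D' \<noteq> {}"
  have "map_prod f g ` D' \<subseteq> E" "map_prod f g ` D' \<noteq> {}"
    using D D' by auto
  then obtain i j where "(i, j) \<in> map_prod f g ` D'"
    and ij: "(\<forall>l. (i, l) \<in> map_prod f g ` D' \<longrightarrow> l = j) \<or> (\<forall>k. (k, j) \<in> map_prod f g ` D' \<longrightarrow> k = i)"
    using E unfolding forest_relation_def by meson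
  then obtain i' j' where e: "(i', j') \<in> D'" and [simp]: "i = f i'" "j = g j'"
    by auto
  have "(f k, g l) \<in> map_prod f g ` D'" if "(k, l) \<in> D'" for k l
    using that by force
  with ij have "(\<forall>l. (i', l) \<in> D' \<longrightarrow> l = j') \<or> (\<forall>k. (k, j') \<in> D' \<longrightarrow> k = i')"
    by (auto simp: inj_eq[OF f] inj_eq[OF g])
  with e show "\<exists>i j. (i, j) \<in> D' \<and> ((\<forall>l. (i, l) \<in> D' \<longrightarrow> l = j) \<or> (\<forall>k. (k, j) \<in> D' \<longrightarrow> k = i))"
    by blast
qed

text \<open>
  A leaf is a line with a single nonzero entry \<open>\<plusminus>1\<close>, so the determinant equals, up to sign, the minor
  belonging to that entry, and the support of the minor is again a forest.
\<close>

lemma det_forest_support: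
  fixes A :: "int mat"
  assumes "A \<in> carrier_mat n n"
    and "\<And>i j. i < n \<Longrightarrow> j < n \<Longrightarrow> A $$ (i, j) \<in> {-1, 0, 1}"
    and "forest_relation {(i, j). i < n \<and> j < n \<and> A $$ (i, j) \<noteq> 0}"
  shows "\<bar>det A\<bar> \<le> 1"
  using assms
proof (induction n arbitrary: A)
  case 0
  then show ?case by simp
next
  case (Suc n)
  note A = Suc.prems(1)
  let ?E = "{(i, j). i < Suc n \<and> j < Suc n \<and> A $$ (i, j) \<noteq> 0}"
  show ?case
  proof (cases "?E = {}")
    case True
    then have "det A = 0"
      using laplace_expansion_row[OF A, of 0] by (auto intro!: sum.neutral)
    then show ?thesis by simp
  next
    case False
    have "\<exists>i j. (i, j) \<in> ?E \<and> ((\<forall>l. (i, l) \<in> ?E \<longrightarrow> l = j) \<or> (\<forall>k. (k, j) \<in> ?E \<longrightarrow> k = i))"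
      using Suc.prems(3)[unfolded forest_relation_def, rule_format, OF subset_refl False] .
    then obtain i j where e: "(i, j) \<in> ?E"
      and leaf: "(\<forall>l. (i, l) \<in> ?E \<longrightarrow> l = j) \<or> (\<forall>k. (k, j) \<in> ?E \<longrightarrow> k = i)"
      by blast
    from e have ij: "i < Suc n" "j < Suc n" by auto
    have single: "det A = A $$ (i, j) * cofactor A i j"
      using leaf
    proof
      assume "\<forall>l. (i, l) \<in> ?E \<longrightarrow> l = j"
      then have "(\<Sum>l<Suc n. A $$ (i, l) * cofactor A i l) = (\<Sum>l\<in>{j}. A $$ (i, l) * cofactor A i l)"
        using ij by (intro sum.mono_neutral_right) auto
      then show ?thesis
        using laplace_expansion_row[OF A ij(1)] by simp
    next
      assume "\<forall>k. (k, j) \<in> ?E \<longrightarrow> k = i"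
      then have "(\<Sum>k<Suc n. A $$ (k, j) * cofactor A k j) = (\<Sum>k\<in>{i}. A $$ (k, j) * cofactor A k j)"
        using ij by (intro sum.mono_neutral_right) auto
      then show ?thesis
        using laplace_expansion_column[OF A ij(2)] by simp
    qed
    let ?D = "mat_delete A i j"
    have D: "?D $$ (k, l) = A $$ (insert_index i k, insert_index j l)" if "k < n" "l < n" for k l
      using that A by (auto simp: mat_delete_def insert_index_def)
    have ins: "insert_index k l < Suc n" if "l < n" for k l
      using that by (auto simp: insert_index_def)
    have inj: "inj (insert_index k)" for k
      by (auto simp: inj_on_def insert_index_def split: if_splits)
    have "\<bar>det ?D\<bar> \<le> 1"
    proof (rule Suc.IH)
      show "?D \<in> carrier_mat n n"
        using mat_delete_carrier[OF A] by simp
      show "?D $$ (k, l) \<in> {-1, 0, 1}" if "k < n" "l < n" for k l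
        using that Suc.prems(2) ins by (simp add: D)
      show "forest_relation {(k, l). k < n \<and> l < n \<and> ?D $$ (k, l) \<noteq> 0}"
        by (rule forest_relation_inv_image[OF Suc.prems(3) inj[of i] inj[of j]])
          (auto simp: D ins)
    qed
    moreover have "\<bar>A $$ (i, j)\<bar> \<le> 1"
      using Suc.prems(2)[OF ij] by auto
    ultimately show ?thesis
      unfolding single cofactor_def abs_mult power_abs by (simp add: mult_le_one)
  qed
qed

section \<open>Expanding added entries into unit rows\<close>

text \<open>
  The list \<open>K\<close> prescribes rows that are replaced by unit vectors: a pair \<open>(i, l)\<close> turns row \<open>i\<close> into the
  \<open>l\<close>-th unit vector. The list \<open>L\<close> names the positions at which \<open>1\<close> is added, and it does not touch replaced
  rows.
\<close>

definition unit_rows_mat :: "nat \<Rightarrow> (nat \<Rightarrow> nat \<Rightarrow> int) \<Rightarrow> (nat \<times> nat) list \<Rightarrow> (nat \<times> nat) list \<Rightarrow> int mat" where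
  "unit_rows_mat n F K L = mat n n (\<lambda>(i, j). case map_of K i of
       Some l \<Rightarrow> of_bool (j = l)
     | None \<Rightarrow> F i j + (\<Sum>e\<leftarrow>L. of_bool (e = (i, j))))"

text \<open>
  A row can be replaced only once. Giving the value \<open>0\<close> to contradictory replacements makes the expansion
  \<open>unit_rows_det_Cons\<close> hold even if several added entries lie in the same row, which happens when the
  two extra edges share a vertex.
\<close>

definition unit_rows_det :: "nat \<Rightarrow> (nat \<Rightarrow> nat \<Rightarrow> int) \<Rightarrow> (nat \<times> nat) list \<Rightarrow> (nat \<times> nat) list \<Rightarrow> int" where
  "unit_rows_det n F K L = (if distinct (map fst K) then det (unit_rows_mat n F K L) else 0)"

lemma unit_rows_mat_carrier [simp]: "unit_rows_mat n F K L \<in> carrier_mat n n"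
  and unit_rows_mat_dim [simp]: "dim_row (unit_rows_mat n F K L) = n" "dim_col (unit_rows_mat n F K L) = n"
  by (simp_all add: unit_rows_mat_def)

lemma unit_rows_mat_index:
  "i < n \<Longrightarrow> j < n \<Longrightarrow> unit_rows_mat n F K L $$ (i, j) = (case map_of K i of
       Some l \<Rightarrow> of_bool (j = l)
     | None \<Rightarrow> F i j + (\<Sum>e\<leftarrow>L. of_bool (e = (i, j))))"
  by (simp add: unit_rows_mat_def)

lemma cofactor_unit_rows_mat:
  assumes "i < n" "j < n" "i \<notin> fst ` set K"
  shows "cofactor (unit_rows_mat n F K L) i j = det (unit_rows_mat n F ((i, j) # K) L)"
proof -
  have "mat n n (\<lambda>(k, l). if k = i then of_bool (l = j) else unit_rows_mat n F K L $$ (k, l)) =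
      unit_rows_mat n F ((i, j) # K) L"
    by (intro eq_matI) (auto simp: unit_rows_mat_index)
  with det_unit_row[of "unit_rows_mat n F K L" n i j] assms show ?thesis
    by simp
qed

lemma unit_rows_det_Cons:
  assumes "i < n" "j < n"
  shows "unit_rows_det n F K ((i, j) # L) = unit_rows_det n F K L + unit_rows_det n F ((i, j) # K) L"
proof (cases "i \<in> fst ` set K")
  case True
  then have "map_of K i \<noteq> None"
    by (simp add: map_of_eq_None_iff)
  then have "unit_rows_mat n F K ((i, j) # L) = unit_rows_mat n F K L"
    by (intro eq_matI) (auto simp: unit_rows_mat_index split: option.split)
  with True show ?thesis
    by (simp add: unit_rows_det_def)
next
  case False
  then have None: "map_of K i = None"
    by (simp add: map_of_eq_None_iff)
  let ?M = "unit_rows_mat n F K ((i, j) # L)" and ?M' = "unit_rows_mat n F K L"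
  have cof: "cofactor ?M i l = cofactor ?M' i l" for l
    by (rule cofactor_cong_row) (auto simp: unit_rows_mat_index split: option.split)
  have "det ?M = (\<Sum>l<n. (?M' $$ (i, l) + of_bool (l = j)) * cofactor ?M' i l)"
    using assms None
    by (subst laplace_expansion_row[of _ n i]) (auto simp: cof unit_rows_mat_index intro!: sum.cong)
  also have "\<dots> = (\<Sum>l<n. ?M' $$ (i, l) * cofactor ?M' i l) + (\<Sum>l<n. of_bool (l = j) * cofactor ?M' i l)"
    by (simp add: distrib_right sum.distrib)
  also have "(\<Sum>l<n. of_bool (l = j) * cofactor ?M' i l) = cofactor ?M' i j"
    using assms by (simp add: of_bool_def if_distrib[of "\<lambda>x. x * _"] cong: if_cong)
  also have "(\<Sum>l<n. ?M' $$ (i, l) * cofactor ?M' i l) = det ?M'"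
    using assms by (intro laplace_expansion_row[symmetric]) simp_all
  finally show ?thesis
    using False assms cofactor_unit_rows_mat[of i n j K F L] by (simp add: unit_rows_det_def)
qed

text \<open>
  An entry in a replaced row is the only one in its row, hence a leaf of every set of entries that
  contains it. So replacing rows by unit vectors keeps the support a forest.
\<close>

lemma unit_rows_det_forest:
  assumes F: "\<And>i j. i < n \<Longrightarrow> j < n \<Longrightarrow> F i j \<in> {-1, 0, 1}"
    and forest: "forest_relation {(i, j). i < n \<and> j < n \<and> F i j \<noteq> 0}"
  shows "\<bar>unit_rows_det n F K []\<bar> \<le> 1"
proof -
  let ?M = "unit_rows_mat n F K []"
  let ?E = "{(i, j). i < n \<and> j < n \<and> F i j \<noteq> 0}"
  have "\<bar>det ?M\<bar> \<le> 1"
  proof (rule det_forest_support)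
    show "?M $$ (i, j) \<in> {-1, 0, 1}" if "i < n" "j < n" for i j
      using F that by (auto simp: unit_rows_mat_index split: option.split)
    show "forest_relation {(i, j). i < n \<and> j < n \<and> ?M $$ (i, j) \<noteq> 0}"
      unfolding forest_relation_def
    proof (intro allI impI)
      fix E assume E: "E \<subseteq> {(i, j). i < n \<and> j < n \<and> ?M $$ (i, j) \<noteq> 0}" "E \<noteq> {}"
      show "\<exists>i j. (i, j) \<in> E \<and> ((\<forall>l. (i, l) \<in> E \<longrightarrow> l = j) \<or> (\<forall>k. (k, j) \<in> E \<longrightarrow> k = i))"
      proof (cases "\<exists>i j. (i, j) \<in> E \<and> map_of K i \<noteq> None")
        case True
        then obtain i j m where ij: "(i, j) \<in> E" "map_of K i = Some m"
          by auto
        then have "(i, l) \<in> E \<Longrightarrow> l = m" for l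
          using E by (auto simp: unit_rows_mat_index dest!: subsetD)
        with ij show ?thesis
          by metis
      next
        case False
        then have "E \<subseteq> ?E"
          using E by (fastforce simp: unit_rows_mat_index)
        with E(2) forest show ?thesis
          unfolding forest_relation_def by blast
      qed
    qed
  qed simp
  then show ?thesis
    by (simp add: unit_rows_det_def)
qed

lemma sum_map_of:
  assumes "distinct (map fst K)" "finite I" "fst ` set K \<subseteq> I"
  shows "(\<Sum>i\<in>I. case map_of K i of None \<Rightarrow> 0 | Some l \<Rightarrow> g i l) = (\<Sum>(i, l)\<leftarrow>K. (g i l :: int))"
  using assms
proof (induction K)
  case Nil
  then show ?case by simp
next
  case (Cons e K)
  obtain k m where e: "e = (k, m)" by force
  have k: "map_of K k = None"
    using Cons.prems e by (simp add: map_of_eq_None_iff)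
  have "(\<Sum>i\<in>I. case map_of (e # K) i of None \<Rightarrow> 0 | Some l \<Rightarrow> g i l) =
      (\<Sum>i\<in>I. (if i = k then g k m else 0) + (case map_of K i of None \<Rightarrow> 0 | Some l \<Rightarrow> g i l))"
    using k by (intro sum.cong) (auto simp: e)
  also have "\<dots> = g k m + (\<Sum>(i, l)\<leftarrow>K. g i l)"
    using Cons e by (simp add: sum.distrib)
  finally show ?case by (simp add: e)
qed

text \<open>
  A nonzero determinant has a permutation \<open>p\<close> all of whose entries are nonzero. Summing
  \<open>\<chi> i + \<chi> (p i)\<close> over all \<open>i\<close> counts every colour twice. On the other hand only the replaced rows
  contribute, since the entries of \<open>F\<close> join opposite colours.
\<close>

lemma unit_rows_det_nonzero_imp_colour_sum:
  fixes \<chi> :: "nat \<Rightarrow> int"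
  assumes \<chi>: "\<And>i j. i < n \<Longrightarrow> j < n \<Longrightarrow> F i j \<noteq> 0 \<Longrightarrow> \<chi> i + \<chi> j = 0"
    and K: "fst ` set K \<subseteq> {..<n}"
    and nz: "unit_rows_det n F K [] \<noteq> 0"
  shows "(\<Sum>(i, j)\<leftarrow>K. \<chi> i + \<chi> j) = 2 * (\<Sum>i<n. \<chi> i)"
proof -
  let ?M = "unit_rows_mat n F K []"
  have dist: "distinct (map fst K)" and "det ?M \<noteq> 0"
    using nz by (auto simp: unit_rows_det_def split: if_splits)
  then obtain p where p: "p permutes {0..<n}" and "(\<Prod>i = 0..<n. ?M $$ (i, p i)) \<noteq> 0"
    by (subst (asm) det_def'[of _ n]) (auto elim!: sum.not_neutral_contains_not_neutral)
  then have nz': "?M $$ (i, p i) \<noteq> 0" if "i < n" for i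
    using that by auto
  have pn: "p i < n" if "i < n" for i
    using permutes_in_image[OF p, of i] that by simp
  have "2 * (\<Sum>i<n. \<chi> i) = (\<Sum>i<n. \<chi> i) + (\<Sum>i<n. \<chi> (p i))"
    using sum.permute[OF p, of \<chi>] by (simp add: atLeast0LessThan comp_def)
  also have "\<dots> = (\<Sum>i<n. \<chi> i + \<chi> (p i))"
    by (simp add: sum.distrib)
  also have "\<dots> = (\<Sum>i<n. case map_of K i of None \<Rightarrow> 0 | Some l \<Rightarrow> \<chi> i + \<chi> l)"
  proof (rule sum.cong[OF refl])
    fix i assume "i \<in> {..<n}"
    then show "\<chi> i + \<chi> (p i) = (case map_of K i of None \<Rightarrow> 0 | Some l \<Rightarrow> \<chi> i + \<chi> l)"
      using nz'[of i] pn[of i] \<chi>[of i "p i"] by (auto simp: unit_rows_mat_index split: option.splits)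
  qed
  also have "\<dots> = (\<Sum>(i, j)\<leftarrow>K. \<chi> i + \<chi> j)"
    using dist K by (intro sum_map_of) auto
  finally show ?thesis ..
qed

section \<open>Parity of symmetric determinants\<close>

lemma of_int_bit_eq_iff: "(of_int x :: bit) = of_int y \<longleftrightarrow> even (x - y)"
proof -
  have "(of_int z :: bit) = of_bool (odd z)" for z
    by (cases "even z") (auto elim!: evenE oddE)
  then show ?thesis by auto
qed

lemma det_cong_even:
  assumes A: "A \<in> carrier_mat n n" and B: "B \<in> carrier_mat n n"
    and AB: "\<And>i j. i < n \<Longrightarrow> j < n \<Longrightarrow> even (A $$ (i, j) - B $$ (i, j) :: int)"
  shows "even (det A - det B)"
proof -
  have "map_mat (of_int :: int \<Rightarrow> bit) A = map_mat of_int B"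
    using assms by (intro eq_matI) (auto simp: of_int_bit_eq_iff)
  then have "of_int (det A) = (of_int (det B) :: bit)"
    by (metis of_int_hom.hom_det)
  then show ?thesis
    by (simp add: of_int_bit_eq_iff)
qed

text \<open>
  Modulo 2 the matrix agrees with a skew-symmetric one, whose determinant vanishes in odd order.
\<close>

lemma even_det_symmetric_odd_order:
  fixes A :: "int mat"
  assumes A: "A \<in> carrier_mat n n" and "odd n"
    and sym: "\<And>i j. i < n \<Longrightarrow> j < n \<Longrightarrow> A $$ (i, j) = A $$ (j, i)"
    and diag: "\<And>i. i < n \<Longrightarrow> even (A $$ (i, i))"
  shows "even (det A)"
proof -
  define S where "S = mat n n (\<lambda>(i, j). if i < j then A $$ (i, j) else if j < i then - A $$ (i, j) else 0)"
  have S: "S \<in> carrier_mat n n"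
    by (simp add: S_def)
  have "S\<^sup>T = (-1) \<cdot>\<^sub>m S"
    by (intro eq_matI) (auto simp: S_def sym)
  then have "det S = (-1) ^ n * det S"
    using det_transpose[OF S] S by simp
  then have "det S = 0"
    using \<open>odd n\<close> by simp
  moreover have "even (det A - det S)"
    by (rule det_cong_even[OF A S]) (auto simp: S_def diag)
  ultimately show ?thesis by simp
qed

text \<open>
  Over the field with two elements the matrix is singular. A null vector \<open>v\<close>, lifted to the integers,
  is used for a unimodular congruence \<open>B = T * A * T\<^sup>T\<close> which makes row \<open>k\<close> and column \<open>k\<close> of \<open>B\<close> even. In the
  expansion along row \<open>k\<close> every entry is then even, and so is every cofactor: those off the diagonal
  still contain the even column \<open>k\<close>, and the diagonal one is a symmetric determinant of odd order.
\<close>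

lemma det_symmetric_even_diag_mod_4:
  fixes A :: "int mat"
  assumes A: "A \<in> carrier_mat n n" and n: "even n"
    and sym: "\<And>i j. i < n \<Longrightarrow> j < n \<Longrightarrow> A $$ (i, j) = A $$ (j, i)"
    and diag: "\<And>i. i < n \<Longrightarrow> even (A $$ (i, i))"
    and even: "even (det A)"
  shows "4 dvd det A"
proof -
  let ?b = "of_int :: int \<Rightarrow> bit"
  have "det (map_mat ?b A) = 0"
    using even of_int_bit_eq_iff[of "det A" 0] by (simp add: of_int_hom.hom_det)
  then obtain w where w: "w \<in> carrier_vec n" "w \<noteq> 0\<^sub>v n" and Aw: "map_mat ?b A *\<^sub>v w = 0\<^sub>v n"
    using det_0_iff_vec_prod_zero_field[of "map_mat ?b A" n] A by auto
  define v :: "nat \<Rightarrow> int" where "v i = of_bool (w $ i = 1)" for i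
  have wv: "w $ i = ?b (v i)" for i
    by (cases "w $ i") (auto simp: v_def)
  obtain k where k: "k < n" "w $ k \<noteq> 0"
    using w by (metis carrier_vecD eq_vecI index_zero_vec(1) index_zero_vec(2))
  then have vk: "v k = 1"
    by (simp add: v_def)
  have even_Av: "even (\<Sum>j<n. A $$ (i, j) * v j)" if i: "i < n" for i
  proof -
    have "?b (\<Sum>j<n. A $$ (i, j) * v j) = (map_mat ?b A *\<^sub>v w) $ i"
      using A i w(1) by (simp add: scalar_prod_def wv atLeast0LessThan)
    also have "\<dots> = ?b 0"
      using Aw i by simp
    finally show ?thesis
      unfolding of_int_bit_eq_iff by simp
  qed
  \<comment> \<open>The identity matrix with row \<open>k\<close> replaced by the null vector, where \<open>v k = 1\<close>.\<close>
  define T where "T = mat n n (\<lambda>(i, j). if i = k then v j else of_bool (i = j))"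
  have T: "T \<in> carrier_mat n n"
    by (simp add: T_def)
  have "mat_delete T k k = 1\<^sub>m (n - 1)"
    by (intro eq_matI) (auto simp: T_def mat_delete_def)
  then have cof_T: "cofactor T k k = 1"
    by (simp add: cofactor_def)
  have T_col: "T $$ (i, k) = of_bool (i = k)" if "i < n" for i
    using that k(1) vk by (simp add: T_def)
  have "det T = (\<Sum>i<n. T $$ (i, k) * cofactor T i k)"
    using laplace_expansion_column[OF T k(1)] .
  also have "\<dots> = (\<Sum>i\<in>{k}. T $$ (i, k) * cofactor T i k)"
    using k(1) by (intro sum.mono_neutral_right) (auto simp: T_col)
  finally have det_T: "det T = 1"
    using k(1) by (simp add: T_col cof_T)
  define B where "B = T * A * T\<^sup>T"
  have B: "B \<in> carrier_mat n n"
    using A T by (simp add: B_def)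
  have det_B: "det B = det A"
    unfolding B_def using A T det_transpose[OF T] det_T by (simp add: det_mult[of _ n])
  have TA: "(T * A) $$ (i, j) = (if i = k then (\<Sum>l<n. A $$ (j, l) * v l) else A $$ (i, j))"
    if "i < n" "j < n" for i j
  proof -
    have "(T * A) $$ (i, j) = (\<Sum>l<n. (if i = k then v l else of_bool (i = l)) * A $$ (l, j))"
      using that A by (simp add: T_def scalar_prod_def atLeast0LessThan)
    also have "\<dots> = (if i = k then (\<Sum>l<n. A $$ (j, l) * v l) else A $$ (i, j))"
      using that by (auto simp: of_bool_def sym[of _ j] mult.commute[of "v _"]
          if_distrib[of "\<lambda>x. x * _"] cong: if_cong)
    finally show ?thesis .
  qed
  have B_index: "B $$ (i, j) = (if j = k then (\<Sum>l<n. (T * A) $$ (i, l) * v l) else (T * A) $$ (i, j))"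
    if "i < n" "j < n" for i j
    using that A T unfolding B_def
    by (subst index_mult_mat(1))
       (auto simp: T_def scalar_prod_def atLeast0LessThan of_bool_def
        if_distrib[of "\<lambda>x. _ * x"] simp del: index_mult_mat(1) intro!: sum.cong cong: if_cong)
  have B_row: "even (B $$ (k, j))" if "j < n" for j
    using that k(1) even_Av by (auto simp: B_index TA intro!: dvd_sum)
  have B_col: "even (B $$ (i, k))" if "i < n" for i
    using that k(1) even_Av by (cases "i = k") (auto simp: B_index TA intro!: dvd_sum)
  have B_sym: "B $$ (i, j) = B $$ (j, i)" if "i < n" "j < n" for i j
    using that by (cases "i = k"; cases "j = k") (auto simp: B_index TA sym)
  have B_diag: "even (B $$ (i, i))" if "i < n" for i
  proof (cases "i = k")
    case True
    then show ?thesis using B_row[OF k(1)] by simp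
  next
    case False
    then show ?thesis using that diag by (simp add: B_index TA)
  qed
  have "4 dvd B $$ (k, j) * cofactor B k j" if j: "j < n" for j
  proof -
    have n_pos: "n = Suc (n - 1)"
      using k(1) by simp
    have "even (det (mat_delete B k j))"
    proof (cases "j = k")
      case True
      have "even (det (mat_delete B k k))"
        using B n_pos \<open>even n\<close>
        by (intro even_det_symmetric_odd_order[of _ "n - 1"])
           (auto simp: mat_delete_def B_sym B_diag)
      with True show ?thesis by simp
    next
      case False
      define l where "l = delete_index j k"
      have l: "l < n - 1" "insert_index j l = k"
        using False k(1) j unfolding l_def
        by (auto simp: delete_index_def insert_index_def)
      have D: "mat_delete B k j \<in> carrier_mat (n - 1) (n - 1)"
        using mat_delete_carrier[OF B] .
      have "even (mat_delete B k j $$ (i, l))" if "i < n - 1" for i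
        using that l B B_col[of "insert_index k i"]
        by (auto simp: mat_delete_def insert_index_def split: if_splits)
      then show ?thesis
        using laplace_expansion_column[OF D l(1)] by (auto intro!: dvd_sum)
    qed
    then have "even (cofactor B k j)"
      by (simp add: cofactor_def)
    with B_row[OF j] show ?thesis
      using mult_dvd_mono[of 2 _ 2] by fastforce
  qed
  then have "4 dvd det B"
    using laplace_expansion_row[OF B k(1)] by (auto intro!: dvd_sum)
  then show ?thesis
    by (simp add: det_B)
qed

section \<open>Determinants of bipartite graphs\<close>

lemma det_permute_rows_cols:
  fixes A :: "int mat"
  assumes A: "A \<in> carrier_mat n n" and p: "p permutes {0..<n}"
  shows "det (mat n n (\<lambda>(i, j). A $$ (p i, p j))) = det A"
proof -
  define R where "R = mat n n (\<lambda>(i, j). A $$ (p i, j))"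
  have R: "R \<in> carrier_mat n n"
    by (simp add: R_def)
  have p_less: "p i < n" if "i < n" for i
    using permutes_in_image[OF p, of i] that by simp
  have eq: "mat n n (\<lambda>(i, j). A $$ (p i, p j)) = (mat n n (\<lambda>(i, j). R\<^sup>T $$ (p i, j)))\<^sup>T"
    by (intro eq_matI) (auto simp: R_def p_less)
  have "det (mat n n (\<lambda>(i, j). A $$ (p i, p j))) = det (mat n n (\<lambda>(i, j). R\<^sup>T $$ (p i, j)))"
    unfolding eq by (rule det_transpose[of _ n]) simp
  also have "\<dots> = signof p * det R"
    using det_permute_rows[of "R\<^sup>T" n p] R p det_transpose[OF R] by simp
  also have "det R = signof p * det A"
    unfolding R_def by (rule det_permute_rows[OF A p])
  finally show ?thesis
    by (simp add: sign_def)
qed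

text \<open>
  If the colour classes have different sizes, the determinant vanishes. Otherwise listing one colour
  class before the other brings the matrix into the shape of a block matrix with zero diagonal blocks
  and off-diagonal blocks \<open>H\<close> and \<open>H\<^sup>T\<close>, whose determinant is \<open>(det H)\<^sup>2\<close> up to sign.
\<close>

lemma det_bipartite_symmetric:
  fixes A :: "int mat" and \<chi> :: "nat \<Rightarrow> int"
  assumes A: "A \<in> carrier_mat n n"
    and sym: "\<And>i j. i < n \<Longrightarrow> j < n \<Longrightarrow> A $$ (i, j) = A $$ (j, i)"
    and \<chi>: "\<And>i. i < n \<Longrightarrow> \<chi> i \<in> {-1, 1}"
    and bip: "\<And>i j. i < n \<Longrightarrow> j < n \<Longrightarrow> A $$ (i, j) \<noteq> 0 \<Longrightarrow> \<chi> i + \<chi> j = 0"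
  shows "\<exists>m. \<bar>det A\<bar> = m\<^sup>2"
proof (cases "(\<Sum>i<n. \<chi> i) = 0")
  case False
  have "unit_rows_mat n (\<lambda>i j. A $$ (i, j)) [] [] = A"
    using A by (intro eq_matI) (auto simp: unit_rows_mat_index)
  then have "det A = 0"
    using unit_rows_det_nonzero_imp_colour_sum[of n "\<lambda>i j. A $$ (i, j)" \<chi> "[]"] bip False
    by (auto simp: unit_rows_det_def)
  then show ?thesis
    by (intro exI[of _ 0]) simp
next
  case True
  define xs where "xs = filter (\<lambda>i. \<chi> i = 1) [0..<n]"
  define ys where "ys = filter (\<lambda>i. \<chi> i \<noteq> 1) [0..<n]"
  define p where "p = length xs"
  have set: "set (xs @ ys) = {0..<n}" and dist: "distinct (xs @ ys)"
    by (auto simp: xs_def ys_def)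
  have len: "length (xs @ ys) = n"
    using distinct_card[OF dist] set by simp
  have xs: "\<chi> i = 1" if "i \<in> set xs" for i
    using that by (simp add: xs_def)
  have ys: "\<chi> i = -1" if "i \<in> set ys" for i
    using that \<chi>[of i] by (auto simp: ys_def)
  have "(\<Sum>i<n. \<chi> i) = sum_list (map \<chi> (xs @ ys))"
    using sum_list_distinct_conv_sum_set[OF dist, of \<chi>] set by (simp add: atLeast0LessThan)
  also have "\<dots> = sum_list (map (\<lambda>_. 1) xs) + sum_list (map (\<lambda>_. -1) ys)"
    using xs ys by (simp cong: map_cong)
  finally have q: "length ys = p"
    using True by (simp add: sum_list_triv p_def)
  have n: "n = p + p"
    using len q by (simp add: p_def)
  define f where "f i = (if i < n then (xs @ ys) ! i else i)" for i
  have "bij_betw f {0..<n} {0..<n}"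
    using bij_betw_nth[OF dist, of "{0..<n}" "{0..<n}"] len set
    by (subst bij_betw_cong[of _ _ "(!) (xs @ ys)"]) (auto simp: f_def atLeast0LessThan)
  then have perm: "f permutes {0..<n}"
    by (rule bij_imp_permutes) (simp add: f_def)
  have f_less: "f i < n" if "i < n" for i
    using permutes_in_image[OF perm, of i] that by simp
  have f1: "\<chi> (f i) = 1" if "i < p" for i
    using that xs n by (auto simp: f_def nth_append p_def)
  have f2: "\<chi> (f i) = -1" if "p \<le> i" "i < n" for i
    using that ys n q by (auto simp: f_def nth_append p_def)
  define H where "H = mat p p (\<lambda>(i, j). A $$ (f i, f (p + j)))"
  have H: "H \<in> carrier_mat p p"
    by (simp add: H_def)
  have "mat n n (\<lambda>(i, j). A $$ (f i, f j)) = four_block_mat (0\<^sub>m p p) H H\<^sup>T (0\<^sub>m p p)"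
  proof (intro eq_matI)
    fix i j
    assume "i < dim_row (four_block_mat (0\<^sub>m p p) H H\<^sup>T (0\<^sub>m p p))"
      "j < dim_col (four_block_mat (0\<^sub>m p p) H H\<^sup>T (0\<^sub>m p p))"
    then have ij: "i < n" "j < n"
      using H n by auto
    have "A $$ (f i, f j) = 0" if "\<chi> (f i) + \<chi> (f j) \<noteq> 0"
      using that bip[of "f i" "f j"] f_less ij by auto
    moreover have "A $$ (f i, f j) = A $$ (f j, f i)"
      using sym f_less ij by simp
    ultimately show "mat n n (\<lambda>(i, j). A $$ (f i, f j)) $$ (i, j) =
        four_block_mat (0\<^sub>m p p) H H\<^sup>T (0\<^sub>m p p) $$ (i, j)"
      using ij H n f1[of i] f1[of j] f2[of i] f2[of j]
      by (cases "i < p"; cases "j < p") (auto simp: H_def)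
  qed (use H n in auto)
  then have "det A = det (four_block_mat (0\<^sub>m p p) H H\<^sup>T (0\<^sub>m p p))"
    using det_permute_rows_cols[OF A perm] by simp
  also have "\<dots> = det (0\<^sub>m p p * 0\<^sub>m p p - H * H\<^sup>T)"
    by (rule det_four_block_mat[of _ p]) (use H in auto)
  also have "0\<^sub>m p p * 0\<^sub>m p p - H * H\<^sup>T = (-1) \<cdot>\<^sub>m (H * H\<^sup>T)"
    using H by (intro eq_matI) auto
  also have "det \<dots> = (-1) ^ p * (det H)\<^sup>2"
    using H det_transpose[OF H] by (simp add: det_mult[of _ p] power2_eq_square)
  finally show ?thesis
    by (intro exI[of _ "det H"]) (simp add: abs_mult power_abs)
qed

text \<open>
  Rows \<open>a\<close> and \<open>b\<close> of the cofactor matrix both lie in the kernel of \<open>A\<close>. The combination \<open>y\<close> of them that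
  vanishes at \<open>b\<close> is also annihilated by the nonsingular matrix \<open>M\<close> in which row \<open>a\<close> of \<open>A\<close> is replaced by the
  \<open>b\<close>-th unit vector. So \<open>y = 0\<close>, and its entry at \<open>a\<close> is the claim.
\<close>

lemma cofactor_mult_of_singular:
  fixes A :: "int mat"
  assumes A: "A \<in> carrier_mat n n" and a: "a < n" and b: "b < n"
    and "det A = 0" and nz: "cofactor A a b \<noteq> 0"
  shows "cofactor A a b * cofactor A b a = cofactor A a a * cofactor A b b"
proof -
  have orth: "(\<Sum>j<n. A $$ (i, j) * cofactor A k j) = 0" if "i < n" "k < n" for i k
  proof -
    have "(A * adj_mat A) $$ (i, k) = 0"
      using adj_mat(2)[OF A] \<open>det A = 0\<close> that by simp
    then show ?thesis
      using that A adj_mat(1)[OF A] by (simp add: scalar_prod_def adj_mat_def atLeast0LessThan)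
  qed
  define M where "M = mat n n (\<lambda>(k, l). if k = a then of_bool (l = b) else A $$ (k, l))"
  have M: "M \<in> carrier_mat n n"
    by (simp add: M_def)
  define y where "y = vec n (\<lambda>j. cofactor A a b * cofactor A b j - cofactor A b b * cofactor A a j)"
  have y: "y \<in> carrier_vec n"
    by (simp add: y_def)
  have "M *\<^sub>v y = 0\<^sub>v n"
  proof (intro eq_vecI)
    fix i assume "i < dim_vec (0\<^sub>v n)"
    then have i: "i < n" by simp
    have "(M *\<^sub>v y) $ i = (\<Sum>j<n. M $$ (i, j) * y $ j)"
      using i M by (simp add: scalar_prod_def y_def atLeast0LessThan)
    also have "\<dots> = 0"
    proof (cases "i = a")
      case True
      then have "(\<Sum>j<n. M $$ (i, j) * y $ j) = (\<Sum>j<n. of_bool (j = b) * y $ j)"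
        using i by (intro sum.cong) (auto simp: M_def)
      also have "\<dots> = y $ b"
        using b by (simp add: of_bool_def if_distrib[of "\<lambda>x. x * _"] cong: if_cong)
      finally show ?thesis
        using b by (simp add: y_def)
    next
      case False
      have "(\<Sum>j<n. M $$ (i, j) * y $ j) = (\<Sum>j<n. cofactor A a b * (A $$ (i, j) * cofactor A b j)
          - cofactor A b b * (A $$ (i, j) * cofactor A a j))"
        using i False by (intro sum.cong) (auto simp: M_def y_def algebra_simps)
      also have "\<dots> = 0"
        unfolding sum_subtractf sum_distrib_left[symmetric] using i a b by (simp add: orth)
      finally show ?thesis .
    qed
    finally show "(M *\<^sub>v y) $ i = 0\<^sub>v n $ i"
      using i by simp
  qed (use M in auto)
  moreover have "det M \<noteq> 0"
    using det_unit_row[OF A a b] nz by (simp add: M_def)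
  ultimately have "y = 0\<^sub>v n"
    using det_0_iff_vec_prod_zero[OF M] y by blast
  then have "y $ a = 0"
    using a by simp
  then show ?thesis
    using a by (simp add: y_def algebra_simps)
qed

section \<open>A coloured forest with two extra edges\<close>

locale coloured_forest =
  fixes n :: nat and F :: "nat \<Rightarrow> nat \<Rightarrow> int" and \<chi> :: "nat \<Rightarrow> int"
  assumes F01: "\<And>i j. i < n \<Longrightarrow> j < n \<Longrightarrow> F i j \<in> {0, 1}"
    and F_sym: "\<And>i j. i < n \<Longrightarrow> j < n \<Longrightarrow> F i j = F j i"
    and colour: "\<And>i. i < n \<Longrightarrow> \<chi> i \<in> {-1, 1}"
    and F_colour: "\<And>i j. i < n \<Longrightarrow> j < n \<Longrightarrow> F i j \<noteq> 0 \<Longrightarrow> \<chi> i + \<chi> j = 0"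
    and F_forest: "forest_relation {(i, j). i < n \<and> j < n \<and> F i j \<noteq> 0}"
begin

abbreviation U where "U \<equiv> unit_rows_det n F"

text \<open>
  The difference of the sizes of the two colour classes.
\<close>

abbreviation imbalance where "imbalance \<equiv> (\<Sum>i<n. \<chi> i)"

abbreviation colour_sum where "colour_sum K \<equiv> (\<Sum>(i, j)\<leftarrow>K. \<chi> i + \<chi> j)"

lemma abs_unit_rows_det_Nil_le:
  assumes "fst ` set K \<subseteq> {..<n}"
  shows "\<bar>U K []\<bar> \<le> of_bool (colour_sum K = 2 * imbalance)"
proof -
  have "F i j \<in> {-1, 0, 1}" if "i < n" "j < n" for i j
    using F01[OF that] by auto
  then have "\<bar>U K []\<bar> \<le> 1"
    by (rule unit_rows_det_forest) (use F_forest in auto)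
  moreover have "(\<Sum>(i, j)\<leftarrow>K. \<chi> i + \<chi> j) = 2 * imbalance" if "U K [] \<noteq> 0"
    using unit_rows_det_nonzero_imp_colour_sum[of n F \<chi> K] F_colour assms that by blast
  ultimately show ?thesis by auto
qed

text \<open>
  Every sublist \<open>J\<close> of the added entries yields one summand, and only the summands with the right
  sum of colours survive. The list \<open>K\<close> records the rows that the expansion has already replaced.
\<close>

lemma abs_unit_rows_det_le:
  assumes "fst ` set K \<subseteq> {..<n}" "set L \<subseteq> {..<n} \<times> {..<n}"
  shows "\<bar>U K L\<bar> \<le> (\<Sum>J\<leftarrow>subseqs L. of_bool (colour_sum K + colour_sum J = 2 * imbalance))"
  using assms
proof (induction L arbitrary: K)
  case Nil
  then show ?case
    using abs_unit_rows_det_Nil_le by simp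
next
  case (Cons e L)
  obtain i j where e: "e = (i, j)" by force
  with Cons.prems have ij: "i < n" "j < n" by auto
  have "\<bar>U K (e # L)\<bar> \<le> \<bar>U K L\<bar> + \<bar>U (e # K) L\<bar>"
    unfolding e unit_rows_det_Cons[OF ij] by (rule abs_triangle_ineq)
  also have "\<dots> \<le> (\<Sum>J\<leftarrow>subseqs L. of_bool (colour_sum K + colour_sum J = 2 * imbalance))
      + (\<Sum>J\<leftarrow>subseqs L. of_bool (colour_sum (e # K) + colour_sum J = 2 * imbalance))"
    using Cons.prems ij e by (intro add_mono Cons.IH) auto
  also have "\<dots> = (\<Sum>J\<leftarrow>subseqs (e # L). of_bool (colour_sum K + colour_sum J = 2 * imbalance))"
    by (simp add: Let_def comp_def e add.assoc add.left_commute[of "colour_sum K"] add.commute[of "colour_sum K"])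
  finally show ?case .
qed

lemma imbalance_parity: "even imbalance \<longleftrightarrow> even n"
proof -
  have "even (\<Sum>i<n. \<chi> i + 1)"
  proof (rule dvd_sum)
    fix i assume "i \<in> {..<n}"
    then show "even (\<chi> i + 1)"
      using colour[of i] by auto
  qed
  then show ?thesis
    by (simp add: sum.distrib)
qed

lemma det_eq_U: "det (unit_rows_mat n F [] L) = U [] L"
  by (simp add: unit_rows_det_def)

lemma edges_matrix_sym:
  assumes "i < n" "j < n" "(\<Sum>e\<leftarrow>L. of_bool (e = (i, j))) = (\<Sum>e\<leftarrow>L. of_bool (e = (j, i)) :: int)"
  shows "unit_rows_mat n F [] L $$ (i, j) = unit_rows_mat n F [] L $$ (j, i)"
  using assms(3) F_sym assms(1,2) by (simp add: unit_rows_mat_index)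

lemma edges_matrix_colour:
  assumes "i < n" "j < n" "unit_rows_mat n F [] L $$ (i, j) \<noteq> 0"
    and L: "\<And>k l. (k, l) \<in> set L \<Longrightarrow> \<chi> k + \<chi> l = 0"
  shows "\<chi> i + \<chi> j = 0"
proof (cases "(i, j) \<in> set L")
  case False
  then have "(\<Sum>e\<leftarrow>L. of_bool (e = (i, j)) :: int) = 0"
    by (induction L) auto
  then show ?thesis
    using assms F_colour by (auto simp: unit_rows_mat_index)
qed (use L in auto)

text \<open>
  All added entries join opposite colours, so the whole matrix is that of a bipartite graph.
\<close>

lemma det_two_bichromatic_edges:
  assumes v: "a < n" "b < n" "c < n" "d < n"
    and ab: "\<chi> a + \<chi> b = 0" and cd: "\<chi> c + \<chi> d = 0"
  shows "\<bar>U [] [(a, b), (b, a), (c, d), (d, c)]\<bar> \<in> {0, 1, 4, 9, 16}"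
proof -
  let ?L = "[(a, b), (b, a), (c, d), (d, c)]"
  let ?A = "unit_rows_mat n F [] ?L"
  have "\<exists>m. \<bar>det ?A\<bar> = m\<^sup>2"
  proof (rule det_bipartite_symmetric)
    show "\<chi> i + \<chi> j = 0" if "i < n" "j < n" "?A $$ (i, j) \<noteq> 0" for i j
      using that by (rule edges_matrix_colour) (use ab cd in auto)
    show "?A $$ (i, j) = ?A $$ (j, i)" if "i < n" "j < n" for i j
      using that by (rule edges_matrix_sym) (simp add: conj_commute add.commute add.left_commute)
  qed (use colour in auto)
  then obtain m where m: "\<bar>U [] ?L\<bar> = m\<^sup>2"
    by (auto simp: det_eq_U)
  have "\<bar>U [] ?L\<bar> \<le> 16"
    using abs_unit_rows_det_le[of "[]" ?L] v ab cd
    by (cases "imbalance = 0") (simp_all add: Let_def algebra_simps)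
  then have "\<bar>m\<bar> \<le> 4"
    unfolding m using abs_le_square_iff[of m 4] by simp
  then have "m \<in> {-4, -3, -2, -1, 0, 1, 2, 3, 4}"
    by auto
  then show ?thesis
    unfolding m by (elim insertE emptyE) simp_all
qed

lemma abs_unit_rows_det_bichromatic_le:
  assumes v: "c < n" "d < n" and cd: "\<chi> c + \<chi> d = 0" and K: "fst ` set K \<subseteq> {..<n}"
  shows "\<bar>U K [(c, d), (d, c)]\<bar> \<le> 4 * of_bool (colour_sum K = 2 * imbalance)"
proof -
  have "\<chi> d = - \<chi> c"
    using cd by simp
  then show ?thesis
    using abs_unit_rows_det_le[OF K, of "[(c, d), (d, c)]"] v by (simp add: Let_def)
qed

text \<open>
  The entries of \<open>cd\<close> do not change the sum of colours, so they are kept together, and only the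
  entries of \<open>ab\<close> are expanded. Unless \<open>imbalance = \<chi> a\<close>, this leaves at most one group of four summands.
  Otherwise exactly one of the two entries of \<open>ab\<close> is replaced, which gives the cofactor at \<open>(a, b)\<close> twice.
\<close>

lemma det_one_bichromatic_edge:
  assumes v: "a < n" "b < n" "c < n" "d < n"
    and ab: "\<chi> a + \<chi> b \<noteq> 0" and cd: "\<chi> c + \<chi> d = 0"
  shows "\<bar>U [] [(a, b), (b, a), (c, d), (d, c)]\<bar> \<in> {0, 1, 2, 3, 4, 8}"
proof -
  let ?L = "[(c, d), (d, c)]"
  have e: "\<chi> b = \<chi> a" "\<chi> a \<noteq> 0"
    using ab colour[of a] colour[of b] v by auto
  have exp: "U [] [(a, b), (b, a), (c, d), (d, c)] = U [] ?L + U [(b, a)] ?L + (U [(a, b)] ?L + U [(b, a), (a, b)] ?L)"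
    using v by (subst unit_rows_det_Cons, simp, simp, subst (1 2) unit_rows_det_Cons, simp_all)
  note le = abs_unit_rows_det_bichromatic_le[OF v(3,4) cd]
  note le' = le[of "[]"] le[of "[(b, a)]"] le[of "[(a, b)]"] le[of "[(b, a), (a, b)]"]
  show ?thesis
  proof (cases "imbalance = \<chi> a")
    case False
    have "\<bar>U [] [(a, b), (b, a), (c, d), (d, c)]\<bar> \<le> 4"
      using le' e False v unfolding exp by (auto simp: of_bool_def split: if_splits)
    then show ?thesis by auto
  next
    case True
    let ?B = "unit_rows_mat n F [] ?L"
    have B: "?B \<in> carrier_mat n n" by simp
    have B_sym: "?B $$ (i, j) = ?B $$ (j, i)" if "i < n" "j < n" for i j
      using that by (rule edges_matrix_sym) (simp add: conj_commute add.commute add.left_commute)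
    have B_colour: "\<chi> i + \<chi> j = 0" if "i < n" "j < n" "?B $$ (i, j) \<noteq> 0" for i j
      using that by (rule edges_matrix_colour) (use cd in auto)
    have U_cof: "U [(i, j)] ?L = cofactor ?B i j" if "i < n" "j < n" for i j
      using cofactor_unit_rows_mat[of i n j "[]" F ?L] that by (simp add: unit_rows_det_def)
    \<comment> \<open>Replacing none or both of the entries of \<open>ab\<close> gives a wrong sum of colours. In particular \<open>?B\<close> is singular.\<close>
    have U0: "U [] ?L = 0" and U2: "U [(b, a), (a, b)] ?L = 0"
      using le' e True v by auto
    have "?B\<^sup>T = ?B"
      using B_sym by (intro eq_matI) auto
    then have "cofactor ?B b a = cofactor ?B a b"
      using cofactor_transpose[OF B, of a b] by simp
    define N where "N = cofactor ?B a b"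
    have det: "U [] [(a, b), (b, a), (c, d), (d, c)] = 2 * N"
      using \<open>cofactor ?B b a = cofactor ?B a b\<close> v unfolding exp by (simp add: U0 U2 U_cof N_def)
    have le4: "\<bar>cofactor ?B i j\<bar> \<le> 4" if "i < n" "j < n" for i j
      using le[of "[(i, j)]"] that by (auto simp: U_cof of_bool_def split: if_splits)
    have square: "\<bar>cofactor ?B i i\<bar> \<in> {0, 1, 4}" if i: "i < n" for i
    proof -
      let ?f = "insert_index i"
      have f: "?f k < n" if "k < n - 1" for k
        using that by (auto simp: insert_index_def)
      have D: "mat_delete ?B i i $$ (k, l) = ?B $$ (?f k, ?f l)" if "k < n - 1" "l < n - 1" for k l
        using that by (simp add: mat_delete_def insert_index_def)
      have "\<exists>m. \<bar>det (mat_delete ?B i i)\<bar> = m\<^sup>2"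
      proof (rule det_bipartite_symmetric)
        show "mat_delete ?B i i \<in> carrier_mat (n - 1) (n - 1)"
          using mat_delete_carrier[OF B] .
        show "mat_delete ?B i i $$ (k, l) = mat_delete ?B i i $$ (l, k)" if "k < n - 1" "l < n - 1" for k l
          using that B_sym f by (simp add: D)
        show "(\<chi> \<circ> ?f) k \<in> {-1, 1}" if "k < n - 1" for k
          using colour f that by simp
        show "(\<chi> \<circ> ?f) k + (\<chi> \<circ> ?f) l = 0"
          if "k < n - 1" "l < n - 1" "mat_delete ?B i i $$ (k, l) \<noteq> 0" for k l
          using that f B_colour by (simp add: D)
      qed
      then obtain m where m: "\<bar>cofactor ?B i i\<bar> = m\<^sup>2"
        by (auto simp: cofactor_def abs_mult power_abs)
      then have "\<bar>m\<bar> \<le> 2"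
        using le4[OF i i] abs_le_square_iff[of m 2] by simp
      then have "m \<in> {-2, -1, 0, 1, 2}"
        by auto
      then show ?thesis
        unfolding m by (elim insertE emptyE) simp_all
    qed
    \<comment> \<open>The case \<open>\<bar>N\<bar> = 3\<close> would give \<open>9\<close> as a product of two numbers among \<open>0\<close>, \<open>1\<close>, \<open>4\<close>, up to sign.\<close>
    have "\<bar>N\<bar> \<noteq> 3"
    proof
      assume N3: "\<bar>N\<bar> = 3"
      then have "N * N = cofactor ?B a a * cofactor ?B b b"
        using cofactor_mult_of_singular[OF B v(1,2)] U0 \<open>cofactor ?B b a = cofactor ?B a b\<close>
        by (auto simp: N_def det_eq_U)
      then have "\<bar>N\<bar> * \<bar>N\<bar> = \<bar>cofactor ?B a a\<bar> * \<bar>cofactor ?B b b\<bar>"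
        by (metis abs_mult)
      then show False
        using N3 square[OF v(1)] square[OF v(2)] by auto
    qed
    moreover have "\<bar>N\<bar> \<le> 4"
      using le4 v by (simp add: N_def)
    ultimately have "\<bar>N\<bar> \<in> {0, 1, 2, 4}"
      by auto
    then show ?thesis
      unfolding det abs_mult by auto
  qed
qed

text \<open>
  Each replaced entry now shifts the sum of colours by \<open>2\<close> or \<open>-2\<close>, with one sign for \<open>ab\<close> and one for
  \<open>cd\<close>. The numbers of summands with a given sum are therefore binomial coefficients 1, 4, 6, 4, 1, and
  the middle one belongs to an even imbalance, hence to an even number of vertices. Only there does
  the bound leave room for \<open>6\<close>, which divisibility by 4 excludes.
\<close>

lemma det_no_bichromatic_edge:
  assumes v: "a < n" "b < n" "c < n" "d < n" and ne: "a \<noteq> b" "c \<noteq> d"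
    and ab: "\<chi> a + \<chi> b \<noteq> 0" and cd: "\<chi> c + \<chi> d \<noteq> 0"
  shows "\<bar>U [] [(a, b), (b, a), (c, d), (d, c)]\<bar> \<in> {0, 1, 2, 3, 4, 5}"
proof -
  let ?L = "[(a, b), (b, a), (c, d), (d, c)]"
  let ?A = "unit_rows_mat n F [] ?L"
  define s t where "s = \<chi> a" and "t = \<chi> c"
  have e: "\<chi> a = s" "\<chi> b = s" "\<chi> c = t" "\<chi> d = t" and st: "s \<in> {-1, 1}" "t \<in> {-1, 1}"
    using ab cd colour[of a] colour[of b] colour[of c] colour[of d] v by (auto simp: s_def t_def)
  have bound: "\<bar>U [] ?L\<bar> \<le> (\<Sum>J\<leftarrow>subseqs ?L. of_bool (colour_sum J = 2 * imbalance))"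
    using abs_unit_rows_det_le[of "[]" ?L] v by simp
  have count: "(\<Sum>J\<leftarrow>subseqs ?L. of_bool (colour_sum J = 2 * x)) \<le> (if even x then 6 else 4 :: int)" for x
    using st by (elim insertE emptyE) (auto simp: Let_def e of_bool_def)
  have le6: "\<bar>U [] ?L\<bar> \<le> 6"
    using bound count[of imbalance] by (simp split: if_splits)
  have le4: "odd imbalance \<Longrightarrow> \<bar>U [] ?L\<bar> \<le> 4"
    using bound count[of imbalance] by simp
  have "\<bar>U [] ?L\<bar> \<noteq> 6"
  proof
    assume 6: "\<bar>U [] ?L\<bar> = 6"
    then have "even n"
      using le4 imbalance_parity by auto
    have "F i i = 0" if "i < n" for i
    proof (rule ccontr)
      assume "F i i \<noteq> 0"
      then have "\<chi> i + \<chi> i = 0"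
        using F_colour that by blast
      then show False
        using colour[OF that] by auto
    qed
    then have "?A $$ (i, i) = 0" if "i < n" for i
      using that ne by (auto simp: unit_rows_mat_index)
    moreover have "?A $$ (i, j) = ?A $$ (j, i)" if "i < n" "j < n" for i j
      using that by (rule edges_matrix_sym) (simp add: conj_commute add.commute add.left_commute)
    moreover have "even (U [] ?L)"
      using 6 by presburger
    ultimately have "4 dvd U [] ?L"
      using det_symmetric_even_diag_mod_4[of ?A n] \<open>even n\<close> by (simp add: det_eq_U)
    moreover have "U [] ?L = 6 \<or> U [] ?L = -6"
      using 6 by linarith
    ultimately show False by auto
  qed
  with le6 show ?thesis by auto
qed

lemma swap_extra_edges:
  "U [] [(c, d), (d, c), (a, b), (b, a)] = U [] [(a, b), (b, a), (c, d), (d, c)]"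
  unfolding unit_rows_det_def unit_rows_mat_def by (simp add: algebra_simps)

lemma det_two_extra_edges:
  assumes v: "a < n" "b < n" "c < n" "d < n" and ne: "a \<noteq> b" "c \<noteq> d"
  shows "\<bar>U [] [(a, b), (b, a), (c, d), (d, c)]\<bar> \<in> {0, 1, 2, 3, 4, 5, 8, 9, 16}"
proof -
  consider "\<chi> a + \<chi> b = 0" "\<chi> c + \<chi> d = 0" | "\<chi> a + \<chi> b \<noteq> 0" "\<chi> c + \<chi> d = 0"
    | "\<chi> a + \<chi> b = 0" "\<chi> c + \<chi> d \<noteq> 0" | "\<chi> a + \<chi> b \<noteq> 0" "\<chi> c + \<chi> d \<noteq> 0"
    by blast
  then show ?thesis
  proof cases
    case 1
    then show ?thesis using det_two_bichromatic_edges[OF v] by blast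
  next
    case 2
    then show ?thesis using det_one_bichromatic_edge[OF v] by blast
  next
    case 3
    then show ?thesis using det_one_bichromatic_edge[OF v(3,4,1,2)] unfolding swap_extra_edges by blast
  next
    case 4
    then show ?thesis using det_no_bichromatic_edge[OF v ne] by blast
  qed
qed

end

section \<open>A breadth-first spanning tree\<close>

text \<open>
  The rank to have in mind is the distance to the root of a tree, where the parent is the only neighbour
  closer to the root. An edge at which the largest rank occurs is then a leaf.
\<close>

lemma forest_relation_of_rank:
  fixes d :: "'v \<Rightarrow> nat"
  assumes "finite E" and E_sym: "\<And>u v. (u, v) \<in> E \<Longrightarrow> (v, u) \<in> E"
    and ne: "\<And>u v. (u, v) \<in> E \<Longrightarrow> d u \<noteq> d v"
    and unique: "\<And>u v w. (u, v) \<in> E \<Longrightarrow> (u, w) \<in> E \<Longrightarrow> d v < d u \<Longrightarrow> d w < d u \<Longrightarrow> w = v"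
  shows "forest_relation E"
  unfolding forest_relation_def
proof (intro allI impI)
  fix E' assume E': "E' \<subseteq> E" "E' \<noteq> {}"
  let ?h = "\<lambda>(u, v). max (d u) (d v)"
  have fin: "finite E'"
    using E' \<open>finite E\<close> finite_subset by blast
  then have "Max (?h ` E') \<in> ?h ` E'"
    using E' by (intro Max_in) auto
  then obtain u v where uv: "(u, v) \<in> E'" and "?h (u, v) = Max (?h ` E')"
    by force
  then have h: "max (d k) (d l) \<le> max (d u) (d v)" if "(k, l) \<in> E'" for k l
    using Max_ge[OF finite_imageI[OF fin] imageI[OF that], of ?h]
    unfolding \<open>?h (u, v) = Max (?h ` E')\<close>[symmetric] by simp
  have E: "(k, l) \<in> E" if "(k, l) \<in> E'" for k l
    using that E' by blast
  show "\<exists>u v. (u, v) \<in> E' \<and> ((\<forall>w. (u, w) \<in> E' \<longrightarrow> w = v) \<or> (\<forall>k. (k, v) \<in> E' \<longrightarrow> k = u))"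
  proof (cases "d v < d u")
    case True
    have "w = v" if "(u, w) \<in> E'" for w
      using unique[OF E[OF uv] E[OF that] True] ne[OF E[OF that]] h[OF that] True by simp
    with uv show ?thesis by blast
  next
    case False
    then have less: "d u < d v"
      using ne[OF E[OF uv]] by simp
    have "k = u" if "(k, v) \<in> E'" for k
      using unique[OF E_sym[OF E[OF uv]] E_sym[OF E[OF that]] less] ne[OF E[OF that]] h[OF that] less
      by simp
    with uv show ?thesis by blast
  qed
qed

lemma edge_set_iff:
  assumes "pair_graph G"
  shows "{u, v} \<in> edge_set G \<longleftrightarrow> (u, v) \<in> parcs G"
proof -
  interpret pair_graph G by fact
  have "(v, u) \<in> parcs G" if "(u, v) \<in> parcs G" for u v
    using pair_sym_arcs that by (auto simp: symmetric_def dest: symD)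
  then show ?thesis
    by (auto simp: edge_set_def doubleton_eq_iff)
qed

text \<open>
  The rank is the length of a shortest walk from \<open>r\<close>; the parent is the last vertex before the end of
  such a walk.
\<close>

lemma breadth_first_tree:
  assumes G: "pair_graph G" and conn: "Digraph_Component.connected (with_proj G)"
  obtains r parent and d :: "'a \<Rightarrow> nat" where "r \<in> pverts G"
    "\<And>v. v \<in> pverts G \<Longrightarrow> v \<noteq> r \<Longrightarrow> (v, parent v) \<in> parcs G \<and> d v = Suc (d (parent v))"
proof -
  interpret pair_graph G by fact
  have arc_sym: "(v, u) \<in> parcs G" if "(u, v) \<in> parcs G" for u v
    using pair_sym_arcs that by (auto simp: symmetric_def dest: symD)
  have ne: "pverts G \<noteq> {}" and reach0: "\<And>u v. u \<in> pverts G \<Longrightarrow> v \<in> pverts G \<Longrightarrow> u \<rightarrow>\<^sup>*\<^bsub>G\<^esub> v"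
    using conn unfolding Digraph_Component.connected_def strongly_connected_def
    by (auto simp: reachable_mk_symmetric_eq[OF pair_sym_arcs])
  have reach: "(u, v) \<in> (parcs G)\<^sup>*" if "u \<in> pverts G" "v \<in> pverts G" for u v
    using reachable_rtranclI[OF reach0[OF that]] by simp
  from ne obtain r where r: "r \<in> pverts G"
    by blast
  define d where "d v = (LEAST k. (r, v) \<in> parcs G ^^ k)" for v
  have walk: "(r, v) \<in> parcs G ^^ d v" if "v \<in> pverts G" for v
    using reach[OF r that] unfolding d_def rtrancl_power by (rule LeastI_ex)
  have d_le: "d v \<le> k" if "(r, v) \<in> parcs G ^^ k" for v k
    using that unfolding d_def by (rule Least_le)
  have "\<exists>u. (v, u) \<in> parcs G \<and> d v = Suc (d u)" if v: "v \<in> pverts G" "v \<noteq> r" for v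
  proof -
    obtain k where k: "d v = Suc k"
      using walk[OF v(1)] v(2) by (cases "d v") auto
    then obtain u where u: "(r, u) \<in> parcs G ^^ k" "(u, v) \<in> parcs G"
      using walk[OF v(1)] by auto
    then have "u \<in> pverts G"
      by (auto dest: in_arcsD1)
    then have "d v \<le> Suc (d u)"
      using walk u(2) by (intro d_le) auto
    with d_le[OF u(1)] k arc_sym[OF u(2)] show ?thesis
      by auto
  qed
  then obtain parent where
    "\<And>v. v \<in> pverts G \<Longrightarrow> v \<noteq> r \<Longrightarrow> (v, parent v) \<in> parcs G \<and> d v = Suc (d (parent v))"
    by metis
  with r show ?thesis
    by (rule that)
qed

lemma bicyclic_tree_plus_two_edges:
  assumes B: "bicyclic B"
  obtains r parent a b a' b' and d :: "'a \<Rightarrow> nat" and T where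
    "T = (\<lambda>v. {v, parent v}) ` (pverts B - {r})"
    "\<forall>v\<in>pverts B - {r}. parent v \<in> pverts B \<and> d v = Suc (d (parent v))"
    "edge_set B = insert {a, b} (insert {a', b'} T)"
    "{a, b} \<notin> T" "{a', b'} \<notin> T" "{a, b} \<noteq> {a', b'}"
    "a \<noteq> b" "a' \<noteq> b'" "{a, b, a', b'} \<subseteq> pverts B"
proof -
  have G: "pair_graph B" and conn: "Digraph_Component.connected (with_proj B)"
    and card: "card (edge_set B) = card (pverts B) + 1"
    using B by (auto simp: bicyclic_def)
  interpret pair_graph B by fact
  obtain r parent and d :: "'a \<Rightarrow> nat" where r: "r \<in> pverts B"
    and parent: "\<And>v. v \<in> pverts B \<Longrightarrow> v \<noteq> r \<Longrightarrow> (v, parent v) \<in> parcs B \<and> d v = Suc (d (parent v))"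
    using breadth_first_tree[OF G conn] by blast
  define T where "T = (\<lambda>v. {v, parent v}) ` (pverts B - {r})"
  have "inj_on (\<lambda>v. {v, parent v}) (pverts B - {r})"
  proof (rule inj_onI)
    fix u v assume u: "u \<in> pverts B - {r}" and v: "v \<in> pverts B - {r}"
      and eq: "{u, parent u} = {v, parent v}"
    then show "u = v"
      using parent[of u] parent[of v] by (auto simp: doubleton_eq_iff)
  qed
  then have card_T: "card T = card (pverts B) - 1"
    using r pair_finite_verts by (simp add: T_def card_image)
  have T_sub: "T \<subseteq> edge_set B"
    using parent edge_set_iff[OF G] by (auto simp: T_def)
  have fin: "finite (edge_set B)"
    using pair_finite_arcs by (simp add: edge_set_def)
  have "card (pverts B) > 0"
    using r pair_finite_verts by (auto simp: card_gt_0_iff)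
  then have "card (edge_set B - T) = 2"
    using card card_T T_sub fin by (simp add: card_Diff_subset finite_subset)
  then obtain e e' where e: "edge_set B - T = {e, e'}" "e \<noteq> e'"
    by (auto simp: card_2_iff)
  then have "e \<in> edge_set B" "e' \<in> edge_set B"
    by auto
  then obtain a b a' b' where ab: "e = {a, b}" "(a, b) \<in> parcs B" "e' = {a', b'}" "(a', b') \<in> parcs B"
    by (auto simp: edge_set_def)
  show ?thesis
  proof (rule that[OF T_def, of d a b a' b'])
    show "edge_set B = insert {a, b} (insert {a', b'} T)"
      using e T_sub ab by blast
    show "{a, b} \<notin> T" "{a', b'} \<notin> T" "{a, b} \<noteq> {a', b'}"
      using e ab by auto
    show "a \<noteq> b" "a' \<noteq> b'"
      using ab no_loops' by auto
    show "{a, b, a', b'} \<subseteq> pverts B"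
      using ab by (auto dest: in_arcsD1 in_arcsD2)
    show "\<forall>v\<in>pverts B - {r}. parent v \<in> pverts B \<and> d v = Suc (d (parent v))"
      using parent by (auto dest: in_arcsD2)
  qed
qed

section \<open>Bicyclic graphs\<close>

theorem theorem25:
  fixes B :: "'a pair_pre_digraph" and vs :: "'a list"
  assumes "bicyclic B"
    and "distinct vs" and "set vs = pverts B"
  shows "det (adjacency_matrix B vs)
    \<in> {0, 1, -1, 2, -2, 3, -3, 4, -4, 5, -5, 8, -8, 9, -9, 16, -16}"
proof -
  have G: "pair_graph B"
    using assms(1) by (simp add: bicyclic_def)
  obtain r parent a b a' b' and d :: "'a \<Rightarrow> nat" and T where
    T: "T = (\<lambda>v. {v, parent v}) ` (pverts B - {r})"
    and parent: "\<forall>v\<in>pverts B - {r}. parent v \<in> pverts B \<and> d v = Suc (d (parent v))"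
    and edges: "edge_set B = insert {a, b} (insert {a', b'} T)"
    and new: "{a, b} \<notin> T" "{a', b'} \<notin> T" "{a, b} \<noteq> {a', b'}"
    and ends: "a \<noteq> b" "a' \<noteq> b'" "{a, b, a', b'} \<subseteq> pverts B"
    by (rule bicyclic_tree_plus_two_edges[OF assms(1)], rule that)
  define n where "n = length vs"
  have nth: "vs ! i = vs ! j \<longleftrightarrow> i = j" if "i < n" "j < n" for i j
    using nth_eq_iff_index_eq[OF assms(2)] that by (simp add: n_def)
  have "\<exists>i<n. vs ! i = v" if "v \<in> pverts B" for v
    using that assms(3) by (metis in_set_conv_nth n_def)
  then obtain p q p' q' where ix: "p < n" "q < n" "p' < n" "q' < n"
    and vs: "vs ! p = a" "vs ! q = b" "vs ! p' = a'" "vs ! q' = b'"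
    using ends(3) by (metis insert_subset)
  have pq: "p \<noteq> q" "p' \<noteq> q'"
    using ends(1,2) vs by auto
  have index: "vs ! k = a \<longleftrightarrow> k = p" "vs ! k = b \<longleftrightarrow> k = q"
    "vs ! k = a' \<longleftrightarrow> k = p'" "vs ! k = b' \<longleftrightarrow> k = q'" if "k < n" for k
    using nth[OF that] ix unfolding vs[symmetric] by simp_all
  define F :: "nat \<Rightarrow> nat \<Rightarrow> int" where "F i j = of_bool ({vs ! i, vs ! j} \<in> T)" for i j
  \<comment> \<open>Every tree edge joins consecutive distances, so the parity of the distance is a proper colouring.\<close>
  define \<chi> :: "nat \<Rightarrow> int" where "\<chi> i = (-1) ^ d (vs ! i)" for i
  have T_iff: "{u, v} \<in> T \<longleftrightarrow> (u \<in> pverts B \<and> u \<noteq> r \<and> v = parent u) \<or> (v \<in> pverts B \<and> v \<noteq> r \<and> u = parent v)" for u v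
    by (auto simp: T doubleton_eq_iff)
  have d_diff: "d u = Suc (d v) \<or> d v = Suc (d u)" if "{u, v} \<in> T" for u v
    using that parent unfolding T_iff by auto
  have d_parent: "v = parent u" if "{u, v} \<in> T" "d v < d u" for u v
    using that parent unfolding T_iff by fastforce
  interpret coloured_forest n F \<chi>
  proof
    show "F i j \<in> {0, 1}" for i j
      by (simp add: F_def)
    show "F i j = F j i" for i j
      by (simp add: F_def insert_commute)
    show "\<chi> i \<in> {-1, 1}" for i
      using neg_one_even_power neg_one_odd_power by (cases "even (d (vs ! i))") (auto simp: \<chi>_def)
    show "\<chi> i + \<chi> j = 0" if "F i j \<noteq> 0" for i j
      using d_diff[of "vs ! i" "vs ! j"] that by (auto simp: F_def \<chi>_def)
    show "forest_relation {(i, j). i < n \<and> j < n \<and> F i j \<noteq> 0}"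
    proof (rule forest_relation_of_rank[where d = "\<lambda>i. d (vs ! i)"])
      show "finite {(i, j). i < n \<and> j < n \<and> F i j \<noteq> 0}"
        by (rule finite_subset[of _ "{..<n} \<times> {..<n}"]) auto
      show "(j, i) \<in> {(i, j). i < n \<and> j < n \<and> F i j \<noteq> 0}"
        if "(i, j) \<in> {(i, j). i < n \<and> j < n \<and> F i j \<noteq> 0}" for i j
        using that by (auto simp: F_def insert_commute)
      show "d (vs ! i) \<noteq> d (vs ! j)" if "(i, j) \<in> {(i, j). i < n \<and> j < n \<and> F i j \<noteq> 0}" for i j
        using d_diff[of "vs ! i" "vs ! j"] that by (auto simp: F_def)
      show "l = j" if "(i, j) \<in> {(i, j). i < n \<and> j < n \<and> F i j \<noteq> 0}"
          "(i, l) \<in> {(i, j). i < n \<and> j < n \<and> F i j \<noteq> 0}"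
          "d (vs ! j) < d (vs ! i)" "d (vs ! l) < d (vs ! i)" for i j l
      proof -
        have e: "{vs ! i, vs ! j} \<in> T" "{vs ! i, vs ! l} \<in> T" and "j < n" "l < n"
          using that(1,2) by (simp_all add: F_def)
        then show ?thesis
          using d_parent[OF e(1) that(3)] d_parent[OF e(2) that(4)] nth[of l j] by metis
      qed
    qed
  qed
  have "adjacency_matrix B vs = unit_rows_mat n F [] [(p, q), (q, p), (p', q'), (q', p')]"
  proof (intro eq_matI)
    fix i j assume "i < dim_row (unit_rows_mat n F [] [(p, q), (q, p), (p', q'), (q', p')])"
      "j < dim_col (unit_rows_mat n F [] [(p, q), (q, p), (p', q'), (q', p')])"
    then have ij: "i < n" "j < n" by simp_all
    let ?e = "{vs ! i, vs ! j}"
    have ab: "of_bool ((p, q) = (i, j)) + of_bool ((q, p) = (i, j)) = (of_bool (?e = {a, b}) :: int)"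
      using ij pq(1) by (auto simp: doubleton_eq_iff index)
    have ab': "of_bool ((p', q') = (i, j)) + of_bool ((q', p') = (i, j)) = (of_bool (?e = {a', b'}) :: int)"
      using ij pq(2) by (auto simp: doubleton_eq_iff index)
    have "adjacency_matrix B vs $$ (i, j) = of_bool (?e \<in> edge_set B)"
      using ij by (simp add: adjacency_matrix_def n_def edge_set_iff[OF G])
    also have "\<dots> = of_bool (?e \<in> T) + of_bool (?e = {a, b}) + of_bool (?e = {a', b'})"
      using new unfolding edges by auto
    also have "\<dots> = unit_rows_mat n F [] [(p, q), (q, p), (p', q'), (q', p')] $$ (i, j)"
      using ij unfolding ab[symmetric] ab'[symmetric] by (simp add: unit_rows_mat_index F_def)
    finally show "adjacency_matrix B vs $$ (i, j) = \<dots>" .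
  qed (simp_all add: adjacency_matrix_def n_def)
  then have "\<bar>det (adjacency_matrix B vs)\<bar> \<in> {0, 1, 2, 3, 4, 5, 8, 9, 16}"
    using det_two_extra_edges[OF ix pq] by (simp add: det_eq_U)
  then show ?thesis
    by (auto simp: abs_if split: if_splits)
qed

end
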